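(* For fixed disjoint finite action sets $I$ (inputs) and $O$ (outputs), the relation $\textbf{modal-irioco}$ is a preorder (reflexive and transitive) on the set of weak may-input-enabled IR-MIA over $I$ and $O$.
   Context: An IR-MIA is a tuple $(Q,I,O,\longrightarrow_\Box,\longrightarrow_\Diamond,q_\Phi)$ with a designated initial state (the IR-MIA is identified with its initial state), where $Q$ is a finite set of states containing a failure state $q_\Phi$, $I,O$ are disjoint finite sets of inputs/outputs, $\tau\notin I\cup O$ is internal, and the must-relation $\longrightarrow_\Box$ and may-relation $\longrightarrow_\Diamond$ are subsets of $((Q\setminus\{q_\Phi\})\times I\times Q)\cup((Q\setminus\{q_\Phi\})\times(O\cup\{\tau\})\times(Q\setminus\{q_\Phi\}))$ with: $q\xrightarrow{a}_\Box q'$ implies $q\xrightarrow{a}_\Diamond q'$; for $i\in I$, $q\xrightarrow{i}_\Diamond q_\Phi$ iff $q\xrightarrow{i}_\Box q_\Phi$; and if $q\xrightarrow{i}_\Box q_\Phi$ then every $i$-may-successor of $q$ is $q_\Phi$. For $\gamma\in\{\Box,\Diamond\}$: $q\xrightarrow{a}_\gamma$ means some $a$-successor exists; $q\overset{\epsilon}{\Longrightarrow}_\gamma q'$ means $q=q'$ or $q'$ is reached by finitely many $\tau$-steps of $\longrightarrow_\gamma$; $q\overset{a}{\Longrightarrow}_\gamma q'$ means $q\overset{\epsilon}{\Longrightarrow}_\gamma\xrightarrow{a}_\gamma\overset{\epsilon}{\Longrightarrow}_\gamma q'$, extended to sequences by concatenation. Observations: $\mathrm{init}_\gamma(p)=\{\mu\in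 I\cup O\mid p\overset{\mu}{\Longrightarrow}_\gamma\}\cup\{\varphi\mid p=p_\Phi\}$; $\delta_\Diamond(p)$ iff $\mathrm{init}_\Box(p)\subseteq I$ and $p\neq p_\Phi$; $\delta_\Box(p)$ iff $\mathrm{init}_\Diamond(p)\subseteq I$ and $p\ne p_\Phi$; $\varphi_\Diamond(p)$ iff $p=p_\Phi$ or there exist $p''$, $i\in I$ with $p''\xrightarrow{i}_\Diamond p$ and not $p''\xrightarrow{i}_\Box p$; $\varphi_\Box(p)$ iff $p=p_\Phi$. Add self-loops $p\xrightarrow{\delta}_\gamma p$ iff $\delta_\gamma(p)$ and $p\xrightarrow{\varphi}_\gamma p$ iff $\varphi_\gamma(p)$ ($\delta,\varphi$ fresh symbols). For $\sigma\in(I\cup O\cup\{\delta,\varphi\})^*$: $p\ \mathrm{after}_\gamma\ \sigma=\{p'\mid p\overset{\sigma}{\Longrightarrow}_\gamma p'\}$, $\mathrm{Straces}_\gamma(p)=\{\sigma\mid p\overset{\sigma}{\Longrightarrow}_\gamma\}$, $\mathrm{Out}_\gamma(p)=\{\mu\in O\mid p\xrightarrow{\mu}_\gamma\}\cup\{\delta\mid\delta_\gamma(p)\}\cup\{\varphi\mid\varphi_\gamma(p)\}$, $\mathrm{Out}_\gamma(S)=\bigcup_{p\in S}\mathrm{Out}_\gamma(p)$. An IR-MIA is weak may-input-enabled if for every state $q\neq q_\Phi$ and $i\in I$ there is $q'$ with $q\overset{i}{\Longrightarrow}_\Diamond q'$. For $i,s$ over the same $I,O$ with $i$ weak may-input-enabled: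 $i\ \textbf{modal-irioco}\ s$ iff (1) for all $\sigma\in\mathrm{Straces}_\Diamond(s)$, $\mathrm{Out}_\Diamond(i\ \mathrm{after}_\Diamond\ \sigma)\subseteq\mathrm{Out}_\Diamond(s\ \mathrm{after}_\Diamond\ \sigma)$, and (2) for all $\sigma\in\mathrm{Straces}_\Diamond(i)$, $\mathrm{Out}_\Box(s\ \mathrm{after}_\Diamond\ \sigma)\subseteq\mathrm{Out}_\Box(i\ \mathrm{after}_\Diamond\ \sigma)$. *)

theory Defs
  imports Main
begin

text \<open>
  The internal action \<open>\<tau>\<close> and the observation symbols \<open>\<delta>\<close>, \<open>\<phi>\<close> are
  separate constructors, so they are fresh for the inputs and outputs.
\<close>

datatype 'a label = Act 'a | Tau | Delta | Phi

datatype modality = Box | Dia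

record ('q, 'a) ir_mia =
  states :: "'q set"
  inputs :: "'a set"
  outputs :: "'a set"
  must :: "('q \<times> 'a label \<times> 'q) set"
  may :: "('q \<times> 'a label \<times> 'q) set"
  fail :: 'q
  initial :: 'q

definition transition_space :: "('q, 'a) ir_mia \<Rightarrow> ('q \<times> 'a label \<times> 'q) set" where
  "transition_space M =
     (states M - {fail M}) \<times> Act ` inputs M \<times> states M \<union>
     (states M - {fail M}) \<times> (Act ` outputs M \<union> {Tau}) \<times> (states M - {fail M})"

definition is_ir_mia :: "('q, 'a) ir_mia \<Rightarrow> bool" where
  "is_ir_mia M \<longleftrightarrow>
     finite (states M) \<and> fail M \<in> states M \<and> initial M \<in> states M \<and>
     finite (inputs M) \<and> finite (outputs M) \<and> inputs M \<inter> outputs M = {} \<and>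
     must M \<subseteq> transition_space M \<and> may M \<subseteq> transition_space M \<and>
     must M \<subseteq> may M \<and>
     (\<forall>q. \<forall>i\<in>inputs M. (q, Act i, fail M) \<in> may M \<longleftrightarrow> (q, Act i, fail M) \<in> must M) \<and>
     (\<forall>q q'. \<forall>i\<in>inputs M.
        (q, Act i, fail M) \<in> must M \<longrightarrow> (q, Act i, q') \<in> may M \<longrightarrow> q' = fail M)"

fun trans_rel :: "('q, 'a) ir_mia \<Rightarrow> modality \<Rightarrow> ('q \<times> 'a label \<times> 'q) set" where
  "trans_rel M Box = must M"
| "trans_rel M Dia = may M"

definition weak_eps :: "('q \<times> 'a label \<times> 'q) set \<Rightarrow> 'q \<Rightarrow> 'q \<Rightarrow> bool" where
  "weak_eps R q q' \<longleftrightarrow> (\<lambda>p p'. (p, Tau, p') \<in> R)\<^sup>*\<^sup>* q q'"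

definition weak_step :: "('q \<times> 'a label \<times> 'q) set \<Rightarrow> 'a label \<Rightarrow> 'q \<Rightarrow> 'q \<Rightarrow> bool" where
  "weak_step R a q q' \<longleftrightarrow> (\<exists>p p'. weak_eps R q p \<and> (p, a, p') \<in> R \<and> weak_eps R p' q')"

fun weak_trace :: "('q \<times> 'a label \<times> 'q) set \<Rightarrow> 'a label list \<Rightarrow> 'q \<Rightarrow> 'q \<Rightarrow> bool" where
  "weak_trace R [] q q' \<longleftrightarrow> weak_eps R q q'"
| "weak_trace R (a # \<sigma>) q q' \<longleftrightarrow> (\<exists>p. weak_step R a q p \<and> weak_trace R \<sigma> p q')"

definition init :: "('q, 'a) ir_mia \<Rightarrow> modality \<Rightarrow> 'q \<Rightarrow> 'a label set" where
  "init M \<gamma> p =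
     {Act x | x. x \<in> inputs M \<union> outputs M \<and> (\<exists>p'. weak_step (trans_rel M \<gamma>) (Act x) p p')} \<union>
     (if p = fail M then {Phi} else {})"

text \<open>May-quiescence refers to the must-outputs and vice versa.\<close>

fun quiescent :: "('q, 'a) ir_mia \<Rightarrow> modality \<Rightarrow> 'q \<Rightarrow> bool" where
  "quiescent M Dia p \<longleftrightarrow> init M Box p \<subseteq> Act ` inputs M \<and> p \<noteq> fail M"
| "quiescent M Box p \<longleftrightarrow> init M Dia p \<subseteq> Act ` inputs M \<and> p \<noteq> fail M"

fun failing :: "('q, 'a) ir_mia \<Rightarrow> modality \<Rightarrow> 'q \<Rightarrow> bool" where
  "failing M Dia p \<longleftrightarrow> p = fail M \<or>
     (\<exists>p''. \<exists>i\<in>inputs M. (p'', Act i, p) \<in> may M \<and> (p'', Act i, p) \<notin> must M)"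
| "failing M Box p \<longleftrightarrow> p = fail M"

definition obs_rel :: "('q, 'a) ir_mia \<Rightarrow> modality \<Rightarrow> ('q \<times> 'a label \<times> 'q) set" where
  "obs_rel M \<gamma> = trans_rel M \<gamma> \<union>
     {(p, Delta, p) | p. p \<in> states M \<and> quiescent M \<gamma> p} \<union>
     {(p, Phi, p) | p. p \<in> states M \<and> failing M \<gamma> p}"

definition observations :: "('q, 'a) ir_mia \<Rightarrow> 'a label set" where
  "observations M = Act ` (inputs M \<union> outputs M) \<union> {Delta, Phi}"

definition after :: "('q, 'a) ir_mia \<Rightarrow> modality \<Rightarrow> 'q \<Rightarrow> 'a label list \<Rightarrow> 'q set" where
  "after M \<gamma> p \<sigma> = {p'. weak_trace (obs_rel M \<gamma>) \<sigma> p p'}"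

definition Straces :: "('q, 'a) ir_mia \<Rightarrow> modality \<Rightarrow> 'q \<Rightarrow> 'a label list set" where
  "Straces M \<gamma> p = {\<sigma> \<in> lists (observations M). \<exists>p'. weak_trace (obs_rel M \<gamma>) \<sigma> p p'}"

definition Out :: "('q, 'a) ir_mia \<Rightarrow> modality \<Rightarrow> 'q \<Rightarrow> 'a label set" where
  "Out M \<gamma> p =
     {Act x | x. x \<in> outputs M \<and> (\<exists>p'. (p, Act x, p') \<in> trans_rel M \<gamma>)} \<union>
     (if quiescent M \<gamma> p then {Delta} else {}) \<union>
     (if failing M \<gamma> p then {Phi} else {})"

definition Out_set :: "('q, 'a) ir_mia \<Rightarrow> modality \<Rightarrow> 'q set \<Rightarrow> 'a label set" where
  "Out_set M \<gamma> S = (\<Union>p\<in>S. Out M \<gamma> p)"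

definition weak_may_input_enabled :: "('q, 'a) ir_mia \<Rightarrow> bool" where
  "weak_may_input_enabled M \<longleftrightarrow>
     (\<forall>q\<in>states M - {fail M}. \<forall>i\<in>inputs M. \<exists>q'. weak_step (may M) (Act i) q q')"

definition modal_irioco :: "('q, 'a) ir_mia \<Rightarrow> ('r, 'a) ir_mia \<Rightarrow> bool" where
  "modal_irioco i s \<longleftrightarrow>
     (\<forall>\<sigma>\<in>Straces s Dia (initial s).
        Out_set i Dia (after i Dia (initial i) \<sigma>) \<subseteq> Out_set s Dia (after s Dia (initial s) \<sigma>)) \<and>
     (\<forall>\<sigma>\<in>Straces i Dia (initial i).
        Out_set s Box (after s Dia (initial s) \<sigma>) \<subseteq> Out_set i Box (after i Dia (initial i) \<sigma>))"

definition input_enabled_ir_mias :: "'a set \<Rightarrow> 'a set \<Rightarrow> ('q, 'a) ir_mia set" where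
  "input_enabled_ir_mias Inp Outp =
     {M. is_ir_mia M \<and> inputs M = Inp \<and> outputs M = Outp \<and> weak_may_input_enabled M}"

end

theory Submission
  imports Defs
begin

text \<open>
  Transitivity follows from one fact: if \<open>i\<close> conforms to a weak may-input-enabled \<open>s\<close>, then every
  may-trace of \<open>i\<close> is a may-trace of \<open>s\<close>.  Extending a trace step by step, an output, \<open>\<delta>\<close> or
  \<open>\<phi>\<close> is matched by \<open>s\<close> because of output inclusion, and an input because of input-enabledness,
  unless \<open>s\<close> can only be in its failure state.  In that case \<open>\<phi>\<close> is the only permitted
  observation.  But a non-failure state either is may-quiescent or reaches an output, so \<open>i\<close> can
  only be in its failure state as well and performs no further input.
\<close>

lemma weak_eps_refl: "weak_eps R q q"
  unfolding weak_eps_def by simp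

lemma weak_eps_trans: "weak_eps R p q \<Longrightarrow> weak_eps R q r \<Longrightarrow> weak_eps R p r"
  unfolding weak_eps_def by simp

lemma weak_eps_mono:
  assumes "weak_eps R p q" and "R \<subseteq> S"
  shows "weak_eps S p q"
  using assms(1) unfolding weak_eps_def
  by (rule rtranclp_mono[THEN predicate2D, rotated]) (use assms(2) in auto)

lemma weak_step_mono: "weak_step R a p q \<Longrightarrow> R \<subseteq> S \<Longrightarrow> weak_step S a p q"
  unfolding weak_step_def by (meson weak_eps_mono subsetD)

lemma weak_step_if_step: "(p, a, q) \<in> R \<Longrightarrow> weak_step R a p q"
  unfolding weak_step_def using weak_eps_refl[of R p] weak_eps_refl[of R q] by blast

lemma weak_trace_eps: "weak_trace R \<sigma> p q \<Longrightarrow> weak_eps R q r \<Longrightarrow> weak_trace R \<sigma> p r"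
  by (induction \<sigma> arbitrary: p) (auto intro: weak_eps_trans)

text \<open>\<open>weak_trace\<close> peels observations off the front, whereas the trace inclusion
  extends traces at the end. In the base case the leading internal steps are absorbed into the weak
  step.\<close>

lemma weak_trace_snoc:
  "weak_trace R (\<sigma> @ [a]) p q \<longleftrightarrow> (\<exists>r. weak_trace R \<sigma> p r \<and> weak_step R a r q)"
proof (induction \<sigma> arbitrary: p)
  case Nil
  show ?case
    unfolding append_Nil weak_trace.simps weak_step_def
    by (blast intro: weak_eps_refl weak_eps_trans)
next
  case (Cons b \<sigma>)
  then show ?case by auto
qed

lemma weak_eps_closed:
  assumes "weak_eps R p q" and "p \<in> A" and "R \<subseteq> A \<times> UNIV \<times> A"
  shows "q \<in> A"
  using assms(1,2) unfolding weak_eps_def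
  by (induction rule: rtranclp_induct) (use assms(3) in auto)

lemma weak_trace_closed:
  assumes "weak_trace R \<sigma> p q" and "p \<in> A" and "R \<subseteq> A \<times> UNIV \<times> A"
  shows "q \<in> A"
  using assms(1,2)
proof (induction \<sigma> arbitrary: p)
  case Nil
  then show ?case using weak_eps_closed[OF _ _ assms(3)] by simp
next
  case (Cons a \<sigma>)
  then obtain r r' p' where "(r, a, r') \<in> R" "weak_eps R r' p'" "weak_trace R \<sigma> p' q"
    by (auto simp: weak_step_def)
  moreover have "r' \<in> A" using \<open>(r, a, r') \<in> R\<close> assms(3) by auto
  ultimately show ?case using Cons.IH weak_eps_closed[OF _ _ assms(3)] by blast
qed

lemma after_closed_eps:
  "p \<in> after M \<gamma> q \<sigma> \<Longrightarrow> weak_eps (obs_rel M \<gamma>) p p' \<Longrightarrow> p' \<in> after M \<gamma> q \<sigma>"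
  unfolding after_def by (auto intro: weak_trace_eps)

lemma after_snocI:
  "p \<in> after M \<gamma> q \<sigma> \<Longrightarrow> weak_step (obs_rel M \<gamma>) a p p' \<Longrightarrow> p' \<in> after M \<gamma> q (\<sigma> @ [a])"
  unfolding after_def by (auto simp: weak_trace_snoc)

text \<open>The internal steps that precede \<open>a\<close> stay inside the \<open>after\<close>
  set, so a strong \<open>a\<close>-step starts from one of its members. This form is needed because
  \<open>Out\<close> sees strong steps only.\<close>

lemma after_snocE:
  assumes "p' \<in> after M \<gamma> q (\<sigma> @ [a])"
  obtains p r where "p \<in> after M \<gamma> q \<sigma>" and "(p, a, r) \<in> obs_rel M \<gamma>"
proof -
  obtain p\<^sub>0 where p\<^sub>0: "p\<^sub>0 \<in> after M \<gamma> q \<sigma>" and "weak_step (obs_rel M \<gamma>) a p\<^sub>0 p'"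
    using assms unfolding after_def by (auto simp: weak_trace_snoc)
  then obtain p r where "weak_eps (obs_rel M \<gamma>) p\<^sub>0 p" and "(p, a, r) \<in> obs_rel M \<gamma>"
    unfolding weak_step_def by blast
  then show thesis
    using that after_closed_eps[OF p\<^sub>0] by blast
qed

lemma Straces_iff:
  "\<sigma> \<in> Straces M \<gamma> p \<longleftrightarrow> \<sigma> \<in> lists (observations M) \<and> after M \<gamma> p \<sigma> \<noteq> {}"
  unfolding Straces_def after_def by auto

lemma may_obs_rel: "may M \<subseteq> obs_rel M Dia"
  unfolding obs_rel_def by auto

lemma after_subset_states:
  assumes "is_ir_mia M"
  shows "after M Dia (initial M) \<sigma> \<subseteq> states M"
proof -
  have "obs_rel M Dia \<subseteq> states M \<times> UNIV \<times> states M"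
    using assms unfolding obs_rel_def is_ir_mia_def transition_space_def by auto
  then show ?thesis
    using assms weak_trace_closed[of "obs_rel M Dia" \<sigma> "initial M" _ "states M"]
    unfolding after_def is_ir_mia_def by blast
qed

lemma obs_rel_Act: "(p, Act x, r) \<in> obs_rel M Dia \<longleftrightarrow> (p, Act x, r) \<in> may M"
  unfolding obs_rel_def by auto

lemma not_may_from_fail: "is_ir_mia M \<Longrightarrow> (fail M, a, r) \<notin> may M"
  unfolding is_ir_mia_def transition_space_def by auto

text \<open>\<open>transition_space\<close> contains no edges labelled \<open>Delta\<close> or
  \<open>Phi\<close>, so such edges of \<open>obs_rel\<close> can only be the added self-loops,
  which record quiescence and failure.\<close>

lemma Out_if_obs_rel:
  assumes "(p, a, r) \<in> obs_rel M Dia" and "a \<in> Act ` outputs M \<union> {Delta, Phi}"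
    and "is_ir_mia M"
  shows "a \<in> Out M Dia p"
  using assms unfolding obs_rel_def Out_def is_ir_mia_def transition_space_def by auto

text \<open>Self-loops are added at members of \<open>states M\<close> only, whence the second
  premise.\<close>

lemma obs_rel_if_Out:
  assumes "a \<in> Out M Dia p" and "p \<in> states M"
  obtains r where "(p, a, r) \<in> obs_rel M Dia"
  using assms unfolding obs_rel_def Out_def by (auto split: if_splits)

text \<open>A non-failure state without \<open>Delta\<close> has a weak must-output. As
  \<open>must M\<close> is contained in \<open>may M\<close>, the state that emits this output is
  reached internally and lies in the same \<open>after\<close> set, which then shows more than
  \<open>Phi\<close>.\<close>

lemma after_eq_fail_if_Out_Phi:
  assumes M: "is_ir_mia M" and out: "Out_set M Dia (after M Dia q \<sigma>) \<subseteq> {Phi}"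
    and p: "p \<in> after M Dia q \<sigma>"
  shows "p = fail M"
proof (rule ccontr)
  assume nf: "p \<noteq> fail M"
  have "Delta \<notin> Out M Dia p"
    using out p unfolding Out_set_def by auto
  then have "\<not> quiescent M Dia p"
    by (auto simp: Out_def simp del: quiescent.simps)
  \<comment> \<open>Since \<open>p\<close> is not the failure state, \<open>Phi\<close> is absent
    from \<open>init M Box p\<close>, so this \<open>a\<close> is an output.\<close>
  then obtain a where "a \<in> init M Box p" and "a \<notin> Act ` inputs M"
    using nf by auto
  then obtain x p' where x: "x \<in> outputs M" and "weak_step (must M) (Act x) p p'"
    using nf by (auto simp: init_def)
  moreover have "must M \<subseteq> obs_rel M Dia"
    using M may_obs_rel unfolding is_ir_mia_def by blast
  ultimately have "weak_step (obs_rel M Dia) (Act x) p p'"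
    by (blast intro: weak_step_mono)
  then obtain r r' where "weak_eps (obs_rel M Dia) p r" and r: "(r, Act x, r') \<in> obs_rel M Dia"
    unfolding weak_step_def by blast
  then have "r \<in> after M Dia q \<sigma>"
    using after_closed_eps[OF p] by blast
  moreover have "Act x \<in> Out M Dia r"
    using Out_if_obs_rel[OF r _ M] x by blast
  ultimately show False
    using out unfolding Out_set_def by auto
qed

lemma Out_fail: "is_ir_mia M \<Longrightarrow> Out M Dia (fail M) = {Phi}"
  by (simp add: Out_def not_may_from_fail)

lemma Straces_subset_if_modal_irioco:
  assumes i: "is_ir_mia i" and s: "is_ir_mia s" and en: "weak_may_input_enabled s"
    and inp: "inputs i = inputs s" and outp: "outputs i = outputs s"
    and conf: "modal_irioco i s"
  shows "Straces i Dia (initial i) \<subseteq> Straces s Dia (initial s)"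
proof
  show "\<sigma> \<in> Straces s Dia (initial s)" if "\<sigma> \<in> Straces i Dia (initial i)" for \<sigma>
    using that
  proof (induction \<sigma> rule: rev_induct)
    case Nil
    show ?case
      unfolding Straces_def using weak_eps_refl by fastforce
  next
    case (snoc a \<sigma>)
    let ?I = "after i Dia (initial i) \<sigma>" and ?S = "after s Dia (initial s) \<sigma>"
    have obs: "observations i = observations s"
      unfolding observations_def inp outp ..
    have lst: "\<sigma> @ [a] \<in> lists (observations s)"
      using snoc.prems unfolding Straces_iff obs by blast
    obtain p r where p: "p \<in> ?I" and step: "(p, a, r) \<in> obs_rel i Dia"
      using snoc.prems unfolding Straces_iff by (blast elim: after_snocE)
    have \<sigma>: "\<sigma> \<in> Straces s Dia (initial s)"
      using snoc.IH lst p unfolding Straces_iff obs by auto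
    then have out: "Out_set i Dia ?I \<subseteq> Out_set s Dia ?S"
      using conf unfolding modal_irioco_def by blast
    have "\<exists>q\<in>?S. \<exists>q'. weak_step (obs_rel s Dia) a q q'"
    proof (cases "a \<in> Act ` inputs s")
      case True
      then obtain x where a: "a = Act x" and x: "x \<in> inputs s" by blast
      \<comment> \<open>Weak input-enabledness speaks of non-failure states only, so such a state
        has to be found in \<open>?S\<close>.\<close>
      have "\<not> ?S \<subseteq> {fail s}"
      proof
        assume "?S \<subseteq> {fail s}"
        then have "Out_set i Dia ?I \<subseteq> {Phi}"
          using out Out_fail[OF s] unfolding Out_set_def by blast
        then have "p = fail i"
          using after_eq_fail_if_Out_Phi[OF i _ p] by blast
        \<comment> \<open>The failure state has no outgoing may-transition, but \<open>p\<close>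
          performs the input \<open>a\<close>.\<close>
        then show False
          using step not_may_from_fail[OF i] unfolding a obs_rel_Act by blast
      qed
      then obtain q where q: "q \<in> ?S" "q \<noteq> fail s" by blast
      then have "q \<in> states s - {fail s}"
        using after_subset_states[OF s] by blast
      then obtain q' where "weak_step (may s) (Act x) q q'"
        using en x unfolding weak_may_input_enabled_def by blast
      then have "weak_step (obs_rel s Dia) a q q'"
        unfolding a using may_obs_rel by (rule weak_step_mono)
      then show ?thesis
        using q(1) by blast
    next
      case False
      then have "a \<in> Act ` outputs i \<union> {Delta, Phi}"
        using lst outp unfolding observations_def by auto
      then have "a \<in> Out_set i Dia ?I"
        using Out_if_obs_rel[OF step _ i] p unfolding Out_set_def by blast
      then obtain q where q: "q \<in> ?S" "a \<in> Out s Dia q"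
        using out unfolding Out_set_def by blast
      then obtain q' where "(q, a, q') \<in> obs_rel s Dia"
        using obs_rel_if_Out[OF q(2)] after_subset_states[OF s] by blast
      then show ?thesis
        using q(1) weak_step_if_step by fast
    qed
    then obtain q q' where "q \<in> ?S" and "weak_step (obs_rel s Dia) a q q'"
      by blast
    then have "q' \<in> after s Dia (initial s) (\<sigma> @ [a])"
      by (rule after_snocI)
    then show ?case
      using lst unfolding Straces_iff by blast
  qed
qed

lemma modal_irioco_refl: "modal_irioco M M"
  unfolding modal_irioco_def by simp

text \<open>In both conditions the two inclusions are chained through \<open>s\<close>, so the trace
  considered must be a trace of \<open>s\<close>. The inclusion of the traces of \<open>i\<close> in
  those of \<open>s\<close> provides this.\<close>

lemma modal_irioco_trans:
  assumes "is_ir_mia i" and "is_ir_mia s" and "weak_may_input_enabled s"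
    and "inputs i = inputs s" and "outputs i = outputs s"
    and "inputs s = inputs t" and "outputs s = outputs t"
    and i_s: "modal_irioco i s" and s_t: "modal_irioco s t"
  shows "modal_irioco i t"
proof -
  note sub = Straces_subset_if_modal_irioco[OF assms(1-5) i_s]
  have obs: "observations i = observations t"
    unfolding observations_def using assms by simp
  have "Out_set i Dia (after i Dia (initial i) \<sigma>) \<subseteq> Out_set t Dia (after t Dia (initial t) \<sigma>)"
    if \<sigma>: "\<sigma> \<in> Straces t Dia (initial t)" for \<sigma>
  \<comment> \<open>A trace of \<open>t\<close> may fail to be one of \<open>i\<close>; then the
    left-hand side is empty. Otherwise it is a trace of \<open>i\<close>, hence of
    \<open>s\<close>.\<close>
  proof (cases "after i Dia (initial i) \<sigma> = {}")
    case True
    then show ?thesis unfolding Out_set_def by simp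
  next
    case False
    then have "\<sigma> \<in> Straces i Dia (initial i)"
      using \<sigma> unfolding Straces_iff obs by blast
    then have "\<sigma> \<in> Straces s Dia (initial s)"
      using sub by blast
    then show ?thesis
      using i_s s_t \<sigma> unfolding modal_irioco_def by (meson order_trans)
  qed
  moreover have
    "Out_set t Box (after t Dia (initial t) \<sigma>) \<subseteq> Out_set i Box (after i Dia (initial i) \<sigma>)"
    if "\<sigma> \<in> Straces i Dia (initial i)" for \<sigma>
    \<comment> \<open>Here \<open>i_s\<close> is applied to \<open>\<sigma>\<close> as a trace of
      \<open>i\<close>, and \<open>s_t\<close> to \<open>\<sigma>\<close> as a trace of
      \<open>s\<close>.\<close>
    using i_s s_t that subsetD[OF sub that] unfolding modal_irioco_def by (meson order_trans)
  ultimately show ?thesis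
    unfolding modal_irioco_def by blast
qed

theorem theorem3:
  fixes Inp Outp :: "'a set"
  assumes "finite Inp" and "finite Outp" and "Inp \<inter> Outp = {}"
  shows "preorder_on (input_enabled_ir_mias Inp Outp :: ('q, 'a) ir_mia set)
           {(i, s). i \<in> input_enabled_ir_mias Inp Outp \<and>
              s \<in> input_enabled_ir_mias Inp Outp \<and> modal_irioco i s}"
  unfolding preorder_on_def
proof (intro conjI)
  show "trans {(i, s). i \<in> input_enabled_ir_mias Inp Outp \<and>
    s \<in> (input_enabled_ir_mias Inp Outp :: ('q, 'a) ir_mia set) \<and> modal_irioco i s}"
  proof (rule transI, clarify)
    fix i s t :: "('q, 'a) ir_mia"
    assume "i \<in> input_enabled_ir_mias Inp Outp" and "s \<in> input_enabled_ir_mias Inp Outp"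
      and "t \<in> input_enabled_ir_mias Inp Outp" and "modal_irioco i s" and "modal_irioco s t"
    then show "modal_irioco i t"
      unfolding input_enabled_ir_mias_def by (intro modal_irioco_trans[of i s t]) simp_all
  qed
qed (auto simp: refl_on_def modal_irioco_refl)

end
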